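(* Let $S(\mathbf{G}(V,E),\mathbf{M})$ be a constrained switching system with $\mathbf{M}=\{A_1,\dots,A_N\}\subset\mathbb{R}^{n\times n}$. For every node $v\in V$ let $U_0^v=I$ be the identity matrix in $\mathbb{R}^{n\times n}$, and for $k=1,2,\dots$ and every node $v\in V$ let $$U_k^v=\sum_{(v,w,\sigma)\in E}A_\sigma^\top\, U_{k-1}^{w}\,A_\sigma,$$ where the sum runs over all edges whose source is $v$. Then $\hat\rho(S)=0$ if and only if $U^v_{n|V|}=0$ for all $v\in V$.
   Context: $\mathbf{M}=\{A_1,\dots,A_N\}\subset\mathbb{R}^{n\times n}$ is a finite set of matrices. $\mathbf{G}(V,E)$ is an automaton: a finite, directed, labeled, strongly connected graph with node set $V$ and edge set $E$; an edge is a triple $(v,w,\sigma)$ with source $v\in V$, destination $w\in V$ and label $\sigma\in\{1,\dots,N\}$. Strong connectivity is understood to guarantee that paths of arbitrary length exist (in particular $E\neq\emptyset$). No initial or final nodes are specified. A path is a sequence of consecutive edges. A sequence of labels is accepted by $\mathbf{G}$ if it is the sequence of labels along some path of $\mathbf{G}$. $|V|$ is the number of nodes. The constrained switching system $S(\mathbf{G},\mathbf{M})$ is $x_{t+1}=A_{\sigma(t)}x_t$, where $\sigma(0),\dots,\sigma(t)$ is accepted by $\mathbf{G}$. With $\|\cdot\|$ the matrix norm induced by the Euclidean norm, its constrained joint spectral radius is $$\hat\rho(S)=\lim_{t\to\infty}\max\left\{\|A_{\sigma(t-1)}\cdots A_{\sigma(0)}\|^{1/t}:\ \sigma(0),\dots,\sigma(t-1)\text{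 is accepted by }\mathbf{G}\right\}.$$ *)

theory Defs
  imports "HOL-Analysis.Analysis" "Graph_Theory.Digraph_Component"
begin

text \<open>
  An edge is a triple \<open>(v, w, \<sigma>)\<close>: source, destination, label. Taking the triples themselves
  as arcs allows parallel edges with distinct labels, as well as loops.
\<close>

type_synonym 'v edge = "'v \<times> 'v \<times> nat"

abbreviation (input) edge_source :: "'v edge \<Rightarrow> 'v" where
  "edge_source e \<equiv> fst e"

abbreviation (input) edge_dest :: "'v edge \<Rightarrow> 'v" where
  "edge_dest e \<equiv> fst (snd e)"

abbreviation (input) edge_label :: "'v edge \<Rightarrow> nat" where
  "edge_label e \<equiv> snd (snd e)"

definition automaton_graph :: "'v set \<Rightarrow> 'v edge set \<Rightarrow> ('v, 'v edge) pre_digraph" where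
  "automaton_graph V E =
     \<lparr>verts = V, arcs = E, tail = (\<lambda>e. edge_source e), head = (\<lambda>e. edge_dest e)\<rparr>"

text \<open>
  In the library, a single node without edges counts as strongly connected; the condition
  \<open>E \<noteq> {}\<close> excludes it, so that paths of every length exist.
\<close>

definition automaton :: "'v set \<Rightarrow> 'v edge set \<Rightarrow> nat \<Rightarrow> bool" where
  "automaton V E N \<longleftrightarrow>
     fin_digraph (automaton_graph V E) \<and>
     strongly_connected (automaton_graph V E) \<and>
     E \<noteq> {} \<and>
     (\<forall>e\<in>E. edge_label e \<in> {1..N})"

definition accepted :: "'v set \<Rightarrow> 'v edge set \<Rightarrow> nat list \<Rightarrow> bool" where
  "accepted V E ws \<longleftrightarrow>
     (\<exists>u p v. pre_digraph.awalk (automaton_graph V E) u p v \<and> ws = map (\<lambda>e. edge_label e) p)"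

text \<open>
  For \<open>ws = [\<sigma>(0), \<dots>, \<sigma>(t - 1)]\<close> this is \<open>A\<^sub>\<sigma>\<^sub>(\<^sub>t\<^sub>-\<^sub>1\<^sub>) \<cdots> A\<^sub>\<sigma>\<^sub>(\<^sub>0\<^sub>)\<close>: the first label acts first.
\<close>

primrec switching_product :: "(nat \<Rightarrow> real^'n^'n) \<Rightarrow> nat list \<Rightarrow> real^'n^'n" where
  "switching_product A [] = mat 1"
| "switching_product A (\<sigma> # ws) = switching_product A ws ** A \<sigma>"

text \<open>
  The norm that \<^const>\<open>norm\<close> denotes on \<open>real^'n^'n\<close> is the Frobenius norm; the one induced by the
  Euclidean norm is the operator norm \<^const>\<open>onorm\<close>. On an automaton, the maximum is over a
  finite nonempty set and is submultiplicative in \<open>t\<close>, hence the limit exists (Fekete). The value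
  at \<open>t = 0\<close> does not matter.
\<close>

definition cjsr :: "'v set \<Rightarrow> 'v edge set \<Rightarrow> (nat \<Rightarrow> real^'n^'n) \<Rightarrow> real" where
  "cjsr V E A =
     lim (\<lambda>t. Max {root t (onorm (\<lambda>x. switching_product A ws *v x)) | ws.
                     accepted V E ws \<and> length ws = t})"

primrec U :: "'v edge set \<Rightarrow> (nat \<Rightarrow> real^'n^'n) \<Rightarrow> nat \<Rightarrow> 'v \<Rightarrow> real^'n^'n" where
  "U E A 0 v = mat 1"
| "U E A (Suc k) v =
     (\<Sum>e\<in>{e\<in>E. edge_source e = v}.
        transpose (A (edge_label e)) ** U E A k (edge_dest e) ** A (edge_label e))"

end

theory Submission
  imports Defs
begin

text \<open>
  By its recursion, \<open>U\<^sub>k\<^sup>v\<close> is the sum of \<open>M\<^sub>p\<^sup>T M\<^sub>p\<close> over the paths \<open>p\<close> of length \<open>k\<close> that start in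
  \<open>v\<close>, where \<open>M\<^sub>p\<close> is the matrix product along \<open>p\<close>. Hence \<open>x\<^sup>T U\<^sub>k\<^sup>v x\<close> is the sum of the \<open>\<parallel>M\<^sub>p x\<parallel>\<^sup>2\<close>, which
  up to the number of paths is their maximum (\<open>norm_switching_product_le\<close>,
  \<open>ex_walk_dominating_form\<close>).

  If all \<open>U\<^sub>m\<^sup>v\<close> with \<open>m = n |V|\<close> vanish, so do all products of length at least \<open>m\<close>, and the
  constrained joint spectral radius is the limit of an eventually zero sequence.

  For the converse, let \<open>K\<^sub>k\<^sup>v\<close> be the kernel of \<open>U\<^sub>k\<^sup>v\<close>. For fixed \<open>v\<close> these kernels increase with \<open>k\<close>,
  and if at some \<open>k\<close> no node has \<open>K\<^sub>k\<^sub>+\<^sub>1\<^sup>v\<close> larger than \<open>K\<^sub>k\<^sup>v\<close>, then the kernels are constant from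
  \<open>k\<close> on. The sum of their dimensions over \<open>V\<close> is at most \<open>m\<close>, so the kernels are constant from \<open>m\<close> on
  (\<open>kernel_stationary\<close>). The positive semidefinite matrices \<open>U\<^sub>m\<^sup>v\<close> and \<open>U\<^sub>m\<^sub>+\<^sub>1\<^sup>v\<close> then have the same
  kernel, and compactness of the unit sphere gives one \<open>c > 0\<close> such that
  \<open>U\<^sub>m\<^sub>+\<^sub>1\<^sup>v - c U\<^sub>m\<^sup>v\<close> is positive semidefinite for all \<open>v\<close>. This inequality is preserved by the
  recursion, so the form of \<open>U\<^sub>m\<^sub>+\<^sub>k\<^sup>v\<close> is at least \<open>c\<^sup>k\<close> times that of \<open>U\<^sub>m\<^sup>v\<close>. If some \<open>U\<^sub>m\<^sup>v\<close> is
  nonzero, the largest norm of a product of length \<open>t\<close> is therefore bounded below by a positive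
  geometric sequence, and the constrained joint spectral radius is positive. Here one
  has to know that the limit in its definition exists, which is Fekete's lemma.
\<close>

section \<open>Fekete's lemma for submultiplicative sequences\<close>

text \<open>
  The limit is the infimum \<open>L\<close> of the roots. If \<open>a m \<le> c\<^sup>m\<close> for one \<open>m \<ge> 1\<close>, splitting off blocks of
  length \<open>m\<close> gives \<open>a t \<le> K c\<^sup>t\<close> for all \<open>t\<close>, and the root of the constant \<open>K\<close> tends to 1. Working
  with roots instead of logarithms also covers sequences that reach zero.
\<close>

lemma submultiplicative_root_convergent:
  fixes a :: "nat \<Rightarrow> real"
  assumes nonneg: "\<And>t. 0 \<le> a t"
    and submult: "\<And>s t. a (s + t) \<le> a s * a t"
  shows "convergent (\<lambda>t. root t (a t))"
proof -
  define L where "L = (INF t\<in>{1..}. root t (a t))"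
  have bdd: "bdd_below ((\<lambda>t. root t (a t)) ` {1..})"
    using nonneg by (intro bdd_belowI[of _ 0]) auto
  have lower: "L \<le> root t (a t)" if "t \<ge> 1" for t
    unfolding L_def using that by (intro cINF_lower bdd) auto
  have L_nonneg: "0 \<le> L"
    unfolding L_def using nonneg by (intro cINF_greatest) auto
  have upper: "\<forall>\<^sub>F t in sequentially. root t (a t) < b" if b: "L < b" for b
  proof -
    define c where "c = (L + b) / 2"
    have c: "L < c" "c < b" "0 < c"
      using b L_nonneg by (auto simp: c_def)
    obtain m where m: "m \<ge> 1" "root m (a m) < c"
      using c(1) cINF_less_iff[OF _ bdd, of c] unfolding L_def by auto
    have am: "a m \<le> c ^ m"
    proof -
      have "a m = root m (a m) ^ m"
        using m(1) nonneg by simp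
      also have "\<dots> \<le> c ^ m"
        using m nonneg by (intro power_mono) auto
      finally show ?thesis .
    qed
    \<comment> \<open>the sum bounds \<open>a t / c ^ t\<close> for \<open>t < m\<close>; adding 1 makes \<open>K\<close> positive\<close>
    define K where "K = 1 + (\<Sum>r<m. a r / c ^ r)"
    have terms_nonneg: "0 \<le> a r / c ^ r" for r
      using nonneg c(3) by simp
    have K_pos: "K > 0"
      unfolding K_def using sum_nonneg[of "{..<m}" "\<lambda>r. a r / c ^ r"] terms_nonneg by simp
    have geometric: "a t \<le> K * c ^ t" for t
    proof (induction t rule: less_induct)
      case (less t)
      show ?case
      proof (cases "t < m")
        case True
        have "a t / c ^ t \<le> (\<Sum>r<m. a r / c ^ r)"
          using True terms_nonneg by (intro member_le_sum) auto
        then have "a t / c ^ t \<le> K"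
          unfolding K_def by simp
        then show ?thesis
          using c(3) by (simp add: field_simps)
      next
        case False
        then have "a t \<le> a (t - m) * a m"
          using submult[of "t - m" m] by simp
        also have "\<dots> \<le> (K * c ^ (t - m)) * c ^ m"
          using False m less[of "t - m"] am nonneg c(3) K_pos by (intro mult_mono) auto
        also have "\<dots> = K * c ^ t"
          using False by (simp add: power_add[symmetric])
        finally show ?thesis .
      qed
    qed
    have "(\<lambda>t. root t K * c) \<longlonglongrightarrow> 1 * c"
      by (intro tendsto_mult LIMSEQ_root_const K_pos tendsto_const)
    then have "\<forall>\<^sub>F t in sequentially. root t K * c < b"
      using c(2) by (intro order_tendstoD(2)) auto
    then show ?thesis
      using eventually_ge_at_top[of 1]
    proof eventually_elim
      case (elim t)
      have "root t (a t) \<le> root t (K * c ^ t)"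
        using elim geometric by simp
      also have "\<dots> = root t K * c"
        using elim c(3) by (simp add: real_root_mult real_root_power_cancel)
      finally show ?case
        using elim by simp
    qed
  qed
  have "(\<lambda>t. root t (a t)) \<longlonglongrightarrow> L"
  proof (rule order_tendstoI)
    fix b assume "b < L"
    then show "\<forall>\<^sub>F t in sequentially. b < root t (a t)"
      using lower by (intro eventually_sequentiallyI[of 1]) (auto intro: less_le_trans)
  qed (rule upper)
  then show ?thesis
    by (rule convergentI)
qed

section \<open>Comparison of positive semidefinite matrices\<close>

definition psd :: "real^'n^'n \<Rightarrow> bool" where
  "psd M \<longleftrightarrow> (\<forall>x y. x \<bullet> (M *v y) = (M *v x) \<bullet> y) \<and> (\<forall>x. 0 \<le> x \<bullet> (M *v x))"

lemma psd_sym: "psd M \<Longrightarrow> x \<bullet> (M *v y) = (M *v x) \<bullet> y"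
  unfolding psd_def by blast

lemma psd_nonneg: "psd M \<Longrightarrow> 0 \<le> x \<bullet> (M *v x)"
  unfolding psd_def by blast

text \<open>
  Perturbing \<open>x\<close> by a small multiple of \<open>-M x\<close> would make the form negative if \<open>M x\<close> were nonzero.
\<close>

lemma psd_form_eq_0_iff:
  fixes M :: "real^'n^'n"
  assumes M: "psd M"
  shows "x \<bullet> (M *v x) = 0 \<longleftrightarrow> M *v x = 0"
proof
  assume null: "x \<bullet> (M *v x) = 0"
  define y where "y = M *v x"
  define b where "b = y \<bullet> (M *v y)"
  have b: "0 \<le> b"
    unfolding b_def by (rule psd_nonneg[OF M])
  have xy: "x \<bullet> (M *v y) = y \<bullet> y"
    using psd_sym[OF M, of x y] unfolding y_def by simp
  have expand: "(x - s *\<^sub>R y) \<bullet> (M *v (x - s *\<^sub>R y)) = s\<^sup>2 * b - 2 * s * (y \<bullet> y)" for s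
    using null xy
    by (simp add: matrix_vector_mult_diff_distrib matrix_vector_mult_scaleR inner_diff
        b_def power2_eq_square algebra_simps flip: y_def)
  \<comment> \<open>for the step length \<open>s * (y \<bullet> y)\<close> the quadratic term stays below the linear one\<close>
  define s where "s = 1 / (b + 1)"
  have s: "0 < s" "s * b < 1"
    using b by (auto simp: s_def field_simps)
  have "0 \<le> s\<^sup>2 * b - 2 * s * (y \<bullet> y)" for s
    using psd_nonneg[OF M, of "x - s *\<^sub>R y"] expand[of s] by simp
  from this[of "s * (y \<bullet> y)"] have "0 \<le> s * (y \<bullet> y)\<^sup>2 * (s * b - 2)"
    by (simp add: power2_eq_square algebra_simps)
  moreover have "s * (s * b - 2) < 0"
    using s by (intro mult_pos_neg) auto
  ultimately have "(y \<bullet> y)\<^sup>2 \<le> 0"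
    by (metis mult.assoc mult.commute mult_neg_pos not_le)
  then show "M *v x = 0"
    by (simp add: y_def)
qed simp

text \<open>
  On the orthogonal complement of the kernel of \<open>Q\<close> the form of \<open>Q\<close> is positive, so by compactness
  it has a positive minimum on the unit sphere there. Neither form changes when a
  vector of that kernel is added to the argument.
\<close>

lemma psd_dominates_if_kernel_subset:
  fixes P Q :: "real^'n^'n"
  assumes P: "psd P" and Q: "psd Q"
    and ker: "\<And>x. Q *v x = 0 \<Longrightarrow> P *v x = 0"
  shows "\<exists>c>0. \<forall>x. c * (x \<bullet> (P *v x)) \<le> x \<bullet> (Q *v x)"
proof -
  define K where "K = {x. Q *v x = 0}"
  have K: "subspace K"
    unfolding K_def by (rule linear_subspace_kernel) simp
  have W: "subspace (K\<^sup>\<bottom>)"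
    by (rule subspace_orthogonal_comp)
  let ?S = "sphere 0 1 \<inter> K\<^sup>\<bottom>"
  obtain m where m: "m > 0" "\<And>z. z \<in> ?S \<Longrightarrow> m \<le> z \<bullet> (Q *v z)"
  proof (cases "?S = {}")
    case True
    then show ?thesis
      using that[of 1] by auto
  next
    case False
    have "compact ?S"
      by (intro compact_Int_closed closed_subspace W) auto
    moreover have "continuous_on ?S (\<lambda>z. z \<bullet> (Q *v z))"
      by (intro continuous_intros matrix_vector_mult_linear_continuous_on)
    ultimately obtain z where z: "z \<in> ?S" "\<forall>y\<in>?S. z \<bullet> (Q *v z) \<le> y \<bullet> (Q *v y)"
      using continuous_attains_inf[of ?S] False by blast
    have "z \<bullet> (Q *v z) \<noteq> 0"
    proof
      assume "z \<bullet> (Q *v z) = 0"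
      then have "z \<in> K"
        using psd_form_eq_0_iff[OF Q] by (simp add: K_def)
      then have "z \<bullet> z = 0"
        using z(1) by (auto simp: orthogonal_comp_def orthogonal_def)
      then show False
        using z(1) by simp
    qed
    then have "z \<bullet> (Q *v z) > 0"
      using psd_nonneg[OF Q, of z] by simp
    then show ?thesis
      using that z(2) by blast
  qed
  have lower: "m * (norm z)\<^sup>2 \<le> z \<bullet> (Q *v z)" if z: "z \<in> K\<^sup>\<bottom>" for z
  proof (cases "z = 0")
    case False
    have "z /\<^sub>R norm z \<in> ?S"
      using False z W by (auto intro: subspace_scale)
    from m(2)[OF this] show ?thesis
      using False by (simp add: matrix_vector_mult_scaleR field_simps power2_eq_square)
  qed simp
  define B where "B = onorm (\<lambda>x. P *v x) + 1"
  have B: "B > 0"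
    using onorm_pos_le[of "\<lambda>x. P *v x"] by (simp add: B_def)
  have upper: "z \<bullet> (P *v z) \<le> B * (norm z)\<^sup>2" for z
  proof -
    have "z \<bullet> (P *v z) \<le> norm z * norm (P *v z)"
      by (rule norm_cauchy_schwarz)
    also have "\<dots> \<le> norm z * (B * norm z)"
      using onorm[of "\<lambda>x. P *v x" z]
      by (intro mult_left_mono) (auto simp: B_def distrib_right intro: add_increasing2)
    finally show ?thesis
      by (simp add: power2_eq_square algebra_simps)
  qed
  have drop_kernel: "(y + z) \<bullet> (M *v (y + z)) = z \<bullet> (M *v z)"
    if "psd M" "M *v y = 0" for M :: "real^'n^'n" and y z
  proof -
    have "y \<bullet> (M *v z) = 0"
      using psd_sym[OF that(1), of y z] that(2) by simp
    then show ?thesis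
      using that(2) by (simp add: matrix_vector_right_distrib inner_add_left)
  qed
  have "m / B * (x \<bullet> (P *v x)) \<le> x \<bullet> (Q *v x)" for x
  proof -
    obtain y z where yz: "y \<in> K" "z \<in> K\<^sup>\<bottom>" "x = y + z"
      using subspace_sum_orthogonal_comp[OF K] by (metis UNIV_I set_plus_elim)
    have Qy: "Q *v y = 0"
      using yz by (simp add: K_def)
    have "m / B * (z \<bullet> (P *v z)) \<le> m / B * (B * (norm z)\<^sup>2)"
      using m(1) B by (intro mult_left_mono upper) auto
    also have "\<dots> \<le> z \<bullet> (Q *v z)"
      using B lower[OF yz(2)] by simp
    finally show ?thesis
      using drop_kernel[OF P ker[OF Qy], of z] drop_kernel[OF Q Qy, of z] yz(3) by simp
  qed
  then show ?thesis
    using m(1) B by (intro exI[of _ "m / B"]) auto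
qed

section \<open>Paths and matrix products\<close>

abbreviation walk :: "'v set \<Rightarrow> 'v edge set \<Rightarrow> 'v \<Rightarrow> 'v edge list \<Rightarrow> 'v \<Rightarrow> bool" where
  "walk V E \<equiv> pre_digraph.awalk (automaton_graph V E)"

abbreviation labels :: "'v edge list \<Rightarrow> nat list" where
  "labels p \<equiv> map (\<lambda>e. edge_label e) p"

lemma automaton_wf: "automaton V E N \<Longrightarrow> wf_digraph (automaton_graph V E)"
  unfolding automaton_def by (auto dest: fin_digraph.axioms)

lemma automaton_finite:
  assumes "automaton V E N"
  shows "finite V" "finite E"
proof -
  have fin: "fin_digraph (automaton_graph V E)"
    using assms by (simp add: automaton_def)
  show "finite V" "finite E"
    using fin_digraph.finite_verts[OF fin] fin_digraph.finite_arcs[OF fin]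
    by (simp_all add: automaton_graph_def)
qed

lemma automaton_edge_nodes:
  assumes "automaton V E N" "e \<in> E"
  shows "edge_source e \<in> V" "edge_dest e \<in> V"
  using wf_digraph.tail_in_verts[OF automaton_wf[OF assms(1)], of e]
    wf_digraph.head_in_verts[OF automaton_wf[OF assms(1)], of e] assms(2)
  by (auto simp: automaton_graph_def)

lemma walk_Nil:
  assumes aut: "automaton V E N"
  shows "walk V E u [] v \<longleftrightarrow> u = v \<and> u \<in> V"
  unfolding wf_digraph.awalk_Nil_iff[OF automaton_wf[OF aut]] by (simp add: automaton_graph_def)

lemma walk_Cons:
  assumes aut: "automaton V E N"
  shows "walk V E u (e # p) v \<longleftrightarrow> e \<in> E \<and> u = edge_source e \<and> walk V E (edge_dest e) p v"
  unfolding wf_digraph.awalk_Cons_iff[OF automaton_wf[OF aut]] by (simp add: automaton_graph_def)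

text \<open>
  A path to the source of some edge either leaves the node or is empty, and in the latter
  case the node is that source itself.
\<close>

lemma ex_out_edge:
  assumes aut: "automaton V E N" and v: "v \<in> V"
  shows "\<exists>e\<in>E. edge_source e = v"
proof -
  obtain e where e: "e \<in> E"
    using aut by (auto simp: automaton_def)
  have "v \<rightarrow>\<^sup>*\<^bsub>automaton_graph V E\<^esub> edge_source e"
    using aut v automaton_edge_nodes[OF aut e]
    unfolding automaton_def by (auto simp: strongly_connected_def automaton_graph_def)
  then obtain p where p: "walk V E v p (edge_source e)"
    using wf_digraph.reachable_awalk[OF automaton_wf[OF aut]] by blast
  then show ?thesis
    using e by (cases p) (auto simp: walk_Nil[OF aut] walk_Cons[OF aut])
qed

lemma switching_product_append:
  "switching_product A (ws @ ws') = switching_product A ws' ** switching_product A ws"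
  by (induction ws) (simp_all add: matrix_mul_assoc)

lemma accepted_appendD:
  assumes aut: "automaton V E N" and acc: "accepted V E (ws @ ws')"
  shows "accepted V E ws" "accepted V E ws'"
proof -
  obtain u p v where p: "walk V E u p v" "ws @ ws' = labels p"
    using acc by (auto simp: accepted_def)
  then obtain q r where qr: "p = q @ r" "ws = labels q" "ws' = labels r"
    by (auto simp: append_eq_map_conv)
  then obtain w where "walk V E u q w" "walk V E w r v"
    using p(1) wf_digraph.awalk_append_iff[OF automaton_wf[OF aut]] by blast
  then show "accepted V E ws" "accepted V E ws'"
    using qr by (auto simp: accepted_def)
qed

lemma finite_accepted:
  assumes aut: "automaton V E N"
  shows "finite {ws. accepted V E ws \<and> length ws = t}"
proof (rule finite_subset)
  have "set p \<subseteq> E" if "walk V E u p v" for u p v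
    using that by (induction p arbitrary: u) (auto simp: walk_Cons[OF aut])
  then show "{ws. accepted V E ws \<and> length ws = t} \<subseteq>
      {ws. set ws \<subseteq> (\<lambda>e. edge_label e) ` E \<and> length ws = t}"
    by (fastforce simp: accepted_def)
  show "finite {ws. set ws \<subseteq> (\<lambda>e. edge_label e) ` E \<and> length ws = t}"
    using automaton_finite[OF aut] by (intro finite_lists_length_eq) simp
qed

section \<open>The quadratic forms of the iteration\<close>

lemma inner_U_Suc:
  assumes "finite E"
  shows "y \<bullet> (U E A (Suc k) v *v x) =
    (\<Sum>e\<in>{e\<in>E. edge_source e = v}.
      (A (edge_label e) *v y) \<bullet> (U E A k (edge_dest e) *v (A (edge_label e) *v x)))"
proof -
  have sum_mv: "(\<Sum>e\<in>F. M e) *v x = (\<Sum>e\<in>F. M e *v x)"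
    for F :: "'a edge set" and M :: "'a edge \<Rightarrow> real^'b^'b"
    by (induction F rule: infinite_finite_induct)
      (auto simp: matrix_vector_mult_add_rdistrib)
  have adj: "y \<bullet> (transpose B *v z) = (B *v y) \<bullet> z" for B :: "real^'b^'b" and z
    by (metis dot_lmul_matrix inner_commute transpose_matrix_vector)
  show ?thesis
    by (simp add: sum_mv inner_sum_right adj matrix_vector_mul_assoc[symmetric]
        del: transpose_matrix_vector)
qed

lemma psd_U:
  assumes "finite E"
  shows "psd (U E A k v)"
proof (induction k arbitrary: v)
  case 0
  show ?case
    by (simp add: psd_def)
next
  case (Suc k)
  show ?case
    unfolding psd_def
  proof (intro conjI allI)
    fix x y
    have "x \<bullet> (U E A (Suc k) v *v y) = y \<bullet> (U E A (Suc k) v *v x)"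
      unfolding inner_U_Suc[OF assms]
      by (intro sum.cong refl) (rule trans[OF psd_sym[OF Suc] inner_commute])
    then show "x \<bullet> (U E A (Suc k) v *v y) = (U E A (Suc k) v *v x) \<bullet> y"
      by (metis inner_commute)
    show "0 \<le> x \<bullet> (U E A (Suc k) v *v x)"
      unfolding inner_U_Suc[OF assms] by (intro sum_nonneg psd_nonneg Suc)
  qed
qed

lemma U_Suc_kernel_iff:
  assumes fin: "finite E"
  shows "U E A (Suc k) v *v x = 0 \<longleftrightarrow>
    (\<forall>e\<in>E. edge_source e = v \<longrightarrow> U E A k (edge_dest e) *v (A (edge_label e) *v x) = 0)"
proof -
  have "U E A (Suc k) v *v x = 0 \<longleftrightarrow> x \<bullet> (U E A (Suc k) v *v x) = 0"
    using psd_form_eq_0_iff[OF psd_U[OF fin]] by metis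
  also have "\<dots> \<longleftrightarrow> (\<forall>e\<in>{e\<in>E. edge_source e = v}.
      (A (edge_label e) *v x) \<bullet> (U E A k (edge_dest e) *v (A (edge_label e) *v x)) = 0)"
    unfolding inner_U_Suc[OF fin]
    using fin by (intro sum_nonneg_eq_0_iff psd_nonneg psd_U) auto
  finally show ?thesis
    unfolding psd_form_eq_0_iff[OF psd_U[OF fin]] by blast
qed

lemma norm_switching_product_le:
  assumes aut: "automaton V E N" and "walk V E v p w"
  shows "(norm (switching_product A (labels p) *v x))\<^sup>2 \<le> x \<bullet> (U E A (length p) v *v x)"
  using assms(2)
proof (induction p arbitrary: v x)
  case Nil
  show ?case
    by (simp add: power2_norm_eq_inner)
next
  case (Cons e p)
  note fin = automaton_finite(2)[OF aut]
  have e: "e \<in> E" "edge_source e = v" "walk V E (edge_dest e) p w"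
    using Cons.prems walk_Cons[OF aut] by auto
  let ?y = "A (edge_label e) *v x"
  have "(norm (switching_product A (labels (e # p)) *v x))\<^sup>2 =
      (norm (switching_product A (labels p) *v ?y))\<^sup>2"
    by (simp add: matrix_vector_mul_assoc)
  also have "\<dots> \<le> ?y \<bullet> (U E A (length p) (edge_dest e) *v ?y)"
    by (rule Cons.IH[OF e(3)])
  also have "\<dots> \<le> x \<bullet> (U E A (length (e # p)) v *v x)"
    unfolding list.size(4) add_0_right add_Suc_right One_nat_def inner_U_Suc[OF fin]
    using e fin
    by (intro member_le_sum[of e _
          "\<lambda>e. (A (edge_label e) *v x) \<bullet> (U E A (length p) (edge_dest e) *v (A (edge_label e) *v x))"]
        psd_nonneg psd_U) auto
  finally show ?case .
qed

text \<open>
  Following at each node the out-edge with the largest summand loses at most a factor \<open>|E|\<close> per step.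
\<close>

lemma ex_walk_dominating_form:
  assumes aut: "automaton V E N" and "v \<in> V"
  shows "\<exists>p w. walk V E v p w \<and> length p = k \<and>
    x \<bullet> (U E A k v *v x) \<le> card E ^ k * (norm (switching_product A (labels p) *v x))\<^sup>2"
  using assms(2)
proof (induction k arbitrary: v x)
  case 0
  then show ?case
    by (intro exI[of _ "[]"] exI[of _ v]) (simp add: walk_Nil[OF aut] power2_norm_eq_inner)
next
  case (Suc k)
  note fin = automaton_finite(2)[OF aut]
  define F where "F = {e\<in>E. edge_source e = v}"
  define f where "f e = (A (edge_label e) *v x) \<bullet> (U E A k (edge_dest e) *v (A (edge_label e) *v x))"
    for e
  have F: "finite F" "F \<noteq> {}" "F \<subseteq> E"
    using fin ex_out_edge[OF aut Suc.prems] unfolding F_def by (simp, blast, blast)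
  obtain e where e: "e \<in> F" "\<And>e'. e' \<in> F \<Longrightarrow> f e' \<le> f e"
  proof -
    have "Max (f ` F) \<in> f ` F"
      using F by (intro Max_in) auto
    then show ?thesis
      using that F(1) by (metis Max_ge finite_imageI imageE imageI)
  qed
  then have eE: "e \<in> E" "edge_source e = v"
    by (auto simp: F_def)
  have dest: "edge_dest e \<in> V"
    using automaton_edge_nodes[OF aut eE(1)] by simp
  obtain p w where p: "walk V E (edge_dest e) p w" "length p = k"
      "f e \<le> card E ^ k *
        (norm (switching_product A (labels p) *v (A (edge_label e) *v x)))\<^sup>2"
    using Suc.IH[OF dest, of "A (edge_label e) *v x"] unfolding f_def by blast
  have "x \<bullet> (U E A (Suc k) v *v x) = sum f F"
    unfolding inner_U_Suc[OF fin] F_def f_def ..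
  also have "\<dots> \<le> card F * f e"
    using e(2) by (rule sum_bounded_above)
  also have "\<dots> \<le> card E * f e"
    using card_mono[OF fin F(3)] psd_nonneg[OF psd_U[OF fin]]
    by (intro mult_right_mono) (auto simp: f_def)
  also have "\<dots> \<le> card E * (card E ^ k *
      (norm (switching_product A (labels p) *v (A (edge_label e) *v x)))\<^sup>2)"
    using p(3) by (intro mult_left_mono) auto
  also have "\<dots> = card E ^ Suc k * (norm (switching_product A (labels (e # p)) *v x))\<^sup>2"
    by (simp add: matrix_vector_mul_assoc)
  finally show ?case
    using p eE by (intro exI[of _ "e # p"] exI[of _ w]) (auto simp: walk_Cons[OF aut])
qed

section \<open>Stabilisation of the kernels\<close>

text \<open>
  The base case is trivial because \<open>U\<^sub>0\<close> is the identity, and the kernel of a node at step \<open>k + 1\<close>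
  is the intersection, over its out-edges, of the preimages of the kernels at step \<open>k\<close>.
\<close>

lemma kernel_mono:
  assumes fin: "finite E" and "k \<le> l" and "U E A k v *v x = 0"
  shows "U E A l v *v x = 0"
proof -
  have step: "U E A (Suc k) v *v x = 0" if "U E A k v *v x = 0" for k x v
    using that
  proof (induction k arbitrary: v x)
    case 0
    then show ?case
      by (simp add: U_Suc_kernel_iff[OF fin] del: U.simps(2))
  next
    case (Suc k)
    then show ?case
      unfolding U_Suc_kernel_iff[OF fin] by blast
  qed
  show ?thesis
    using assms(2,3) by (induction l rule: dec_induct) (auto intro: step simp del: U.simps)
qed

text \<open>
  As long as the kernels are not constant, the sum of their dimensions grows by at
  least one in each step, and it cannot exceed \<open>n |V|\<close>.
\<close>

lemma kernel_stationary:
  fixes A :: "nat \<Rightarrow> real^'n^'n"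
  assumes aut: "automaton V E N" and v: "v \<in> V"
    and null: "U E A (Suc (CARD('n) * card V)) v *v x = 0"
  shows "U E A (CARD('n) * card V) v *v x = 0"
proof (rule ccontr)
  note fin = automaton_finite[OF aut]
  let ?m = "CARD('n) * card V"
  assume not_null: "U E A ?m v *v x \<noteq> 0"
  define K where "K k u = {x. U E A k u *v x = 0}" for k u
  define D where "D k = (\<Sum>u\<in>V. dim (K k u))" for k
  have subspace_K: "subspace (K k u)" for k u
    unfolding K_def by (rule linear_subspace_kernel) simp
  have K_mono: "K k u \<subseteq> K (Suc k) u" for k u
    unfolding K_def using kernel_mono[OF fin(2), of k "Suc k" A u] by auto
  have K_dim: "dim (K k u) \<le> dim (K (Suc k) u)" for k u
    by (rule dim_subset[OF K_mono])
  have stays_constant: "\<forall>u\<in>V. K (Suc l) u = K l u"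
    if "\<forall>u\<in>V. K (Suc k) u = K k u" "k \<le> l" for k l
    using that(2)
  proof (induction l rule: dec_induct)
    case base
    show ?case
      by (rule that(1))
  next
    case (step l)
    show ?case
    proof
      fix u assume "u \<in> V"
      have "U E A l (edge_dest e) *v y = 0 \<longleftrightarrow> U E A (Suc l) (edge_dest e) *v y = 0"
        if "e \<in> E" for e y
        using step.IH automaton_edge_nodes(2)[OF aut that] unfolding K_def by blast
      then show "K (Suc (Suc l)) u = K (Suc l) u"
        unfolding K_def U_Suc_kernel_iff[OF fin(2), of A "Suc l"]
          U_Suc_kernel_iff[OF fin(2), of A l] by blast
    qed
  qed
  have D_grows: "D k < D (Suc k)" if k: "k \<le> ?m" for k
  proof (rule ccontr)
    assume "\<not> D k < D (Suc k)"
    have "dim (K (Suc k) u) \<le> dim (K k u)" if u: "u \<in> V" for u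
    proof (rule ccontr)
      assume "\<not> ?thesis"
      then have "D k < D (Suc k)"
        unfolding D_def using fin(1) u K_dim by (intro sum_strict_mono_ex1) (auto simp: not_le)
      then show False
        using \<open>\<not> D k < D (Suc k)\<close> by simp
    qed
    then have "\<forall>u\<in>V. K (Suc k) u = K k u"
      using subspace_dim_equal[OF subspace_K subspace_K K_mono] by blast
    then have "K (Suc ?m) v = K ?m v"
      using stays_constant k v by blast
    then show False
      using null not_null unfolding K_def by blast
  qed
  have "k \<le> D k" if "k \<le> Suc ?m" for k
    using that
  proof (induction k)
    case (Suc k)
    then show ?case
      using D_grows[of k] by simp
  qed simp
  then have "Suc ?m \<le> D (Suc ?m)"
    by simp
  also have "\<dots> \<le> (\<Sum>u\<in>V. CARD('n))"
    unfolding D_def by (intro sum_mono dim_subset_UNIV_cart)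
  finally show False
    by (simp add: mult.commute)
qed

text \<open>
  The base case is the comparison of \<open>U\<^sub>m\<^sub>+\<^sub>1\<close> with \<open>U\<^sub>m\<close>, which have the same kernels. The
  recursion is monotone and linear in the family \<open>(U\<^sup>v)\<^sub>v\<close>, which carries the inequality
  to all later indices.
\<close>

lemma U_form_lower_bound:
  fixes A :: "nat \<Rightarrow> real^'n^'n"
  assumes aut: "automaton V E N"
  defines "m \<equiv> CARD('n) * card V"
  shows "\<exists>c>0. \<forall>k. \<forall>v\<in>V. \<forall>x. c ^ k * (x \<bullet> (U E A m v *v x)) \<le> x \<bullet> (U E A (m + k) v *v x)"
proof -
  note fin = automaton_finite[OF aut]
  have "\<forall>v\<in>V. \<exists>c>0. \<forall>x. c * (x \<bullet> (U E A m v *v x)) \<le> x \<bullet> (U E A (Suc m) v *v x)"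
    unfolding m_def
    using kernel_stationary[OF aut]
    by (intro ballI psd_dominates_if_kernel_subset psd_U fin) blast
  then obtain d where d: "\<And>v. v \<in> V \<Longrightarrow> d v > 0"
    "\<And>v x. v \<in> V \<Longrightarrow> d v * (x \<bullet> (U E A m v *v x)) \<le> x \<bullet> (U E A (Suc m) v *v x)"
    by metis
  define c where "c = Min (insert 1 (d ` V))"
  have c: "c > 0" "\<And>v. v \<in> V \<Longrightarrow> c \<le> d v"
    using fin(1) d(1) by (auto simp: c_def)
  have step: "c * (x \<bullet> (U E A (m + k) v *v x)) \<le> x \<bullet> (U E A (Suc (m + k)) v *v x)"
    if "v \<in> V" for k v x
    using that
  proof (induction k arbitrary: v x)
    case 0
    have "c * (x \<bullet> (U E A m v *v x)) \<le> d v * (x \<bullet> (U E A m v *v x))"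
      using 0 by (intro mult_right_mono c psd_nonneg psd_U fin)
    also have "\<dots> \<le> x \<bullet> (U E A (Suc m) v *v x)"
      using 0 by (rule d(2))
    finally show ?case
      by (simp del: U.simps)
  next
    case (Suc k)
    show ?case
      unfolding add_Suc_right inner_U_Suc[OF fin(2), of x A "Suc (m + k)"]
        inner_U_Suc[OF fin(2), of x A "m + k"] sum_distrib_left
      using automaton_edge_nodes(2)[OF aut] by (intro sum_mono Suc.IH) auto
  qed
  have "c ^ k * (x \<bullet> (U E A m v *v x)) \<le> x \<bullet> (U E A (m + k) v *v x)" if v: "v \<in> V" for k v x
  proof (induction k)
    case (Suc k)
    have "c ^ Suc k * (x \<bullet> (U E A m v *v x)) = c * (c ^ k * (x \<bullet> (U E A m v *v x)))"
      by simp
    also have "\<dots> \<le> c * (x \<bullet> (U E A (m + k) v *v x))"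
      using Suc c(1) by (intro mult_left_mono) auto
    also have "\<dots> \<le> x \<bullet> (U E A (Suc (m + k)) v *v x)"
      using v by (rule step)
    finally show ?case
      by (simp only: add_Suc_right)
  qed simp
  then show ?thesis
    using c(1) by blast
qed

section \<open>The constrained joint spectral radius\<close>

definition max_product_norm :: "'v set \<Rightarrow> 'v edge set \<Rightarrow> (nat \<Rightarrow> real^'n^'n) \<Rightarrow> nat \<Rightarrow> real" where
  "max_product_norm V E A t =
     Max ((\<lambda>ws. onorm (\<lambda>x. switching_product A ws *v x)) ` {ws. accepted V E ws \<and> length ws = t})"

lemma accepted_nonempty:
  assumes aut: "automaton V E N"
  shows "{ws. accepted V E ws \<and> length ws = t} \<noteq> {}"
proof -
  obtain v where "v \<in> V"
    using aut automaton_edge_nodes[OF aut] by (fastforce simp: automaton_def)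
  from ex_walk_dominating_form[OF aut this, of t] show ?thesis
    unfolding accepted_def by fastforce
qed

lemma onorm_le_max_product_norm:
  assumes aut: "automaton V E N" and "accepted V E ws"
  shows "onorm (\<lambda>x. switching_product A ws *v x) \<le> max_product_norm V E A (length ws)"
  unfolding max_product_norm_def using assms finite_accepted[OF aut] by (intro Max_ge) auto

lemma max_product_norm_attained:
  assumes aut: "automaton V E N"
  obtains ws where "accepted V E ws" "length ws = t"
    "max_product_norm V E A t = onorm (\<lambda>x. switching_product A ws *v x)"
proof -
  have "max_product_norm V E A t \<in>
      (\<lambda>ws. onorm (\<lambda>x. switching_product A ws *v x)) ` {ws. accepted V E ws \<and> length ws = t}"
    unfolding max_product_norm_def
    using finite_accepted[OF aut] accepted_nonempty[OF aut] by (intro Max_in) auto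
  then show ?thesis
    using that by auto
qed

lemma max_product_norm_nonneg:
  assumes aut: "automaton V E N"
  shows "0 \<le> max_product_norm V E A t"
proof -
  obtain ws where "max_product_norm V E A t = onorm (\<lambda>x. switching_product A ws *v x)"
    using max_product_norm_attained[OF aut] by metis
  then show ?thesis
    by (simp add: onorm_pos_le)
qed

lemma max_product_norm_submult:
  assumes aut: "automaton V E N"
  shows "max_product_norm V E A (s + t) \<le> max_product_norm V E A s * max_product_norm V E A t"
proof -
  obtain ws where ws: "accepted V E ws" "length ws = s + t"
      "max_product_norm V E A (s + t) = onorm (\<lambda>x. switching_product A ws *v x)"
    using max_product_norm_attained[OF aut] by metis
  define p q where "p = take s ws" and "q = drop s ws"
  have pq: "ws = p @ q" "length p = s" "length q = t"
    using ws(2) by (auto simp: p_def q_def)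
  have acc: "accepted V E p" "accepted V E q"
    using accepted_appendD[OF aut, of p q] ws(1) pq(1) by simp_all
  have "max_product_norm V E A (s + t) =
      onorm ((\<lambda>x. switching_product A q *v x) \<circ> (\<lambda>x. switching_product A p *v x))"
    by (simp add: ws(3) pq(1) switching_product_append o_def matrix_vector_mul_assoc)
  also have "\<dots> \<le> onorm (\<lambda>x. switching_product A q *v x) * onorm (\<lambda>x. switching_product A p *v x)"
    by (intro onorm_compose) auto
  also have "\<dots> \<le> max_product_norm V E A t * max_product_norm V E A s"
    using onorm_le_max_product_norm[OF aut acc(1), of A]
      onorm_le_max_product_norm[OF aut acc(2), of A] pq
    by (intro mult_mono) (auto intro: onorm_pos_le max_product_norm_nonneg[OF aut])
  finally show ?thesis
    by (simp add: mult.commute)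
qed

lemma cjsr_eq_lim_max_product_norm:
  assumes aut: "automaton V E N"
  shows "cjsr V E A = lim (\<lambda>t. root t (max_product_norm V E A t))"
proof -
  have "root t (max_product_norm V E A t) =
      Max {root t (onorm (\<lambda>x. switching_product A ws *v x)) | ws. accepted V E ws \<and> length ws = t}"
    for t
  proof -
    have "mono (root t)"
      by (cases "t = 0") (auto intro!: monoI)
    then show ?thesis
      unfolding max_product_norm_def
      using finite_accepted[OF aut] accepted_nonempty[OF aut]
      by (subst mono_Max_commute) (auto simp: image_image setcompr_eq_image)
  qed
  then show ?thesis
    unfolding cjsr_def by simp
qed

text \<open>
  A bare value of \<^const>\<open>lim\<close> says nothing about the sequence; Fekete's lemma makes it a genuine limit.
\<close>

lemma max_product_norm_root_tendsto_cjsr: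
  assumes aut: "automaton V E N"
  shows "(\<lambda>t. root t (max_product_norm V E A t)) \<longlonglongrightarrow> cjsr V E A"
  unfolding cjsr_eq_lim_max_product_norm[OF aut]
  unfolding convergent_LIMSEQ_iff[symmetric]
  by (intro submultiplicative_root_convergent max_product_norm_nonneg[OF aut]
      max_product_norm_submult[OF aut])

lemma max_product_norm_eq_0:
  assumes aut: "automaton V E N" and null: "\<And>v. v \<in> V \<Longrightarrow> U E A k v = 0" and "k \<le> t"
  shows "max_product_norm V E A t = 0"
proof -
  obtain ws where ws: "accepted V E ws" "length ws = t"
      "max_product_norm V E A t = onorm (\<lambda>x. switching_product A ws *v x)"
    using max_product_norm_attained[OF aut] by metis
  obtain u p v where p: "walk V E u p v" "ws = labels p"
    using ws(1) by (auto simp: accepted_def)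
  have u: "u \<in> V"
    using p(1) automaton_edge_nodes[OF aut]
    by (cases p) (auto simp: walk_Nil[OF aut] walk_Cons[OF aut])
  have "switching_product A ws *v x = 0" for x
  proof -
    have "U E A t u *v x = 0"
      by (rule kernel_mono[OF automaton_finite(2)[OF aut] \<open>k \<le> t\<close>]) (simp add: null[OF u])
    then have "(norm (switching_product A ws *v x))\<^sup>2 \<le> 0"
      using norm_switching_product_le[OF aut p(1), of A x] p(2) ws(2) by simp
    then show ?thesis
      by simp
  qed
  then show ?thesis
    using ws(3) by (simp add: onorm_zero)
qed

text \<open>
  At a vector outside the kernel the forms decay at most geometrically, and at each length one
  path carries a fixed geometric share of the form.
\<close>

lemma max_product_norm_geometric_lower_bound:
  fixes A :: "nat \<Rightarrow> real^'n^'n"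
  assumes aut: "automaton V E N" and v: "v \<in> V"
    and nz: "U E A (CARD('n) * card V) v \<noteq> 0"
  shows "\<exists>b>0. \<exists>r>0. \<forall>k. b * r ^ k \<le> (max_product_norm V E A (CARD('n) * card V + k))\<^sup>2"
proof -
  note fin = automaton_finite[OF aut]
  let ?m = "CARD('n) * card V"
  obtain x where x: "U E A ?m v *v x \<noteq> 0"
    using nz by (metis matrix_eq matrix_vector_mult_0)
  define q where "q = x \<bullet> (U E A ?m v *v x)"
  have q: "q > 0"
    unfolding q_def
    using x psd_form_eq_0_iff[OF psd_U[OF fin(2)]] psd_nonneg[OF psd_U[OF fin(2)]]
    by (metis less_eq_real_def)
  obtain c where c: "c > 0"
      "\<And>k. c ^ k * q \<le> x \<bullet> (U E A (?m + k) v *v x)"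
    using U_form_lower_bound[OF aut, of A] v unfolding q_def by blast
  have E: "0 < real (card E)"
    using aut fin(2) by (simp add: automaton_def card_gt_0_iff)
  have nx: "0 < (norm x)\<^sup>2"
    using x by auto
  \<comment> \<open>powers of \<open>card E\<close> bound the number of paths, and \<open>(norm x)\<^sup>2\<close> turns values at \<open>x\<close> into operator norms\<close>
  define b where "b = q / (card E ^ ?m * (norm x)\<^sup>2)"
  define r where "r = c / card E"
  have "b * r ^ k \<le> (max_product_norm V E A (?m + k))\<^sup>2" for k
  proof -
    let ?a = "max_product_norm V E A (?m + k)"
    obtain p w where p: "walk V E v p w" "length p = ?m + k"
        "x \<bullet> (U E A (?m + k) v *v x) \<le>
          card E ^ (?m + k) * (norm (switching_product A (labels p) *v x))\<^sup>2"
      using ex_walk_dominating_form[OF aut v] by blast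
    have "accepted V E (labels p)"
      using p(1) by (auto simp: accepted_def)
    then have "onorm (\<lambda>x. switching_product A (labels p) *v x) \<le> ?a"
      using onorm_le_max_product_norm[OF aut] p(2) by (metis length_map)
    then have "onorm (\<lambda>x. switching_product A (labels p) *v x) * norm x \<le> ?a * norm x"
      by (intro mult_right_mono) auto
    then have "norm (switching_product A (labels p) *v x) \<le> ?a * norm x"
      by (intro order_trans[OF onorm[of "\<lambda>x. switching_product A (labels p) *v x" x]]) auto
    then have "(norm (switching_product A (labels p) *v x))\<^sup>2 \<le> (?a * norm x)\<^sup>2"
      by (intro power_mono) auto
    then have "card E ^ (?m + k) * (norm (switching_product A (labels p) *v x))\<^sup>2
        \<le> card E ^ (?m + k) * (?a * norm x)\<^sup>2"
      by (intro mult_left_mono) auto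
    then have "c ^ k * q \<le> card E ^ (?m + k) * (?a * norm x)\<^sup>2"
      using c(2)[of k] p(3) by linarith
    then show ?thesis
      using E nx
      by (simp add: b_def r_def field_simps power_add power_mult_distrib power_divide)
  qed
  moreover have "b > 0" "r > 0"
    using q nx E c(1) by (auto simp: b_def r_def)
  ultimately show ?thesis
    by blast
qed

lemma cjsr_pos:
  fixes A :: "nat \<Rightarrow> real^'n^'n"
  assumes aut: "automaton V E N" and v: "v \<in> V"
    and nz: "U E A (CARD('n) * card V) v \<noteq> 0"
  shows "cjsr V E A > 0"
proof -
  let ?m = "CARD('n) * card V"
  let ?a = "max_product_norm V E A"
  obtain b r where br: "b > 0" "r > 0" "\<And>k. b * r ^ k \<le> (?a (?m + k))\<^sup>2"
    using max_product_norm_geometric_lower_bound[OF aut v nz] by blast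
  define d where "d = b / r ^ ?m"
  have d: "d > 0"
    using br by (simp add: d_def)
  have bound: "root t d * r \<le> (root t (?a t))\<^sup>2" if t: "t \<ge> ?m + 1" for t
  proof -
    have "d * r ^ t = b * r ^ (t - ?m)"
      using t br(2) by (simp add: d_def power_diff)
    also have "\<dots> \<le> (?a t)\<^sup>2"
      using br(3)[of "t - ?m"] t by simp
    finally have "root t (d * r ^ t) \<le> root t ((?a t)\<^sup>2)"
      using t by simp
    then show ?thesis
      using t br(2) by (simp add: real_root_mult real_root_power_cancel real_root_power)
  qed
  have "(\<lambda>t. root t d * r) \<longlonglongrightarrow> 1 * r"
    by (intro tendsto_mult LIMSEQ_root_const d tendsto_const)
  moreover have "(\<lambda>t. (root t (?a t))\<^sup>2) \<longlonglongrightarrow> (cjsr V E A)\<^sup>2"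
    by (intro tendsto_power max_product_norm_root_tendsto_cjsr[OF aut])
  ultimately have "1 * r \<le> (cjsr V E A)\<^sup>2"
    using bound by (rule_tac LIMSEQ_le) blast+
  then have "cjsr V E A \<noteq> 0"
    using br(2) by auto
  moreover have "0 \<le> cjsr V E A"
    by (intro LIMSEQ_le_const[OF max_product_norm_root_tendsto_cjsr[OF aut]])
      (auto intro: real_root_ge_zero max_product_norm_nonneg[OF aut])
  ultimately show ?thesis
    by simp
qed

theorem proposition3p3:
  fixes V :: "'v set" and E :: "'v edge set" and N :: nat
    and A :: "nat \<Rightarrow> real^'n^'n"
  assumes "automaton V E N"
  shows "cjsr V E A = 0 \<longleftrightarrow> (\<forall>v\<in>V. U E A (CARD('n) * card V) v = 0)"
proof
  assume "cjsr V E A = 0"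
  then show "\<forall>v\<in>V. U E A (CARD('n) * card V) v = 0"
    using cjsr_pos[OF assms] by (metis less_irrefl)
next
  assume "\<forall>v\<in>V. U E A (CARD('n) * card V) v = 0"
  then have "max_product_norm V E A t = 0" if "CARD('n) * card V \<le> t" for t
    using max_product_norm_eq_0[OF assms _ that] by blast
  then have "\<forall>\<^sub>F t in sequentially. root t (max_product_norm V E A t) = 0"
    by (intro eventually_sequentiallyI[of "CARD('n) * card V"]) simp
  then have "(\<lambda>t. root t (max_product_norm V E A t)) \<longlonglongrightarrow> 0"
    by (rule tendsto_eventually)
  then show "cjsr V E A = 0"
    by (rule LIMSEQ_unique[OF max_product_norm_root_tendsto_cjsr[OF assms]])
qed

end
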